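(* For a positive integer $k$ let $g(k)=\min\{|A[1]|+|A\{1\}| : A\subset\mathbb{N},\ |A|=k\}$. Then for every $\varepsilon>0$ there exists $k_0$ such that for all integers $k\ge k_0$, $$k^{(\frac18-\varepsilon)\frac{\ln k}{\ln\ln k}}<g(k)<k^{(1+\varepsilon)\frac{\ln k}{\ln\ln k}}.$$
   Context: $\mathbb{N}$ denotes the positive integers. For a finite set $A=\{a_1,\dots,a_k\}$ of positive integers, the simple sum set is $A[1]=\{\sum_{i=1}^k\varepsilon_i a_i:\varepsilon_i\in\{0,1\}\}$ and the simple product set is $A\{1\}=\{\prod_{i=1}^k a_i^{\varepsilon_i}:\varepsilon_i\in\{0,1\}\}$. *)

theory Defs
  imports Complex_Main
begin

definition simple_sum_set :: "nat set \<Rightarrow> nat set" where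
  "simple_sum_set A = {\<Sum>a\<in>A. \<epsilon> a * a | \<epsilon> :: nat \<Rightarrow> nat. \<forall>a\<in>A. \<epsilon> a \<in> {0, 1}}"

definition simple_product_set :: "nat set \<Rightarrow> nat set" where
  "simple_product_set A = {\<Prod>a\<in>A. a ^ \<epsilon> a | \<epsilon> :: nat \<Rightarrow> nat. \<forall>a\<in>A. \<epsilon> a \<in> {0, 1}}"

definition sum_product_sizes :: "nat \<Rightarrow> nat set" where
  "sum_product_sizes k =
     {card (simple_sum_set A) + card (simple_product_set A) | A.
        finite A \<and> A \<subseteq> {1..} \<and> card A = k}"

text \<open>The infimum of a nonempty set of naturals is its minimum, see \<open>g_mem\<close> and \<open>g_le\<close>.\<close>

definition g :: "nat \<Rightarrow> nat" where
  "g k = Inf (sum_product_sizes k)"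

lemma g_mem: "g k \<in> sum_product_sizes k"
proof -
  have "finite {1..k} \<and> {1..k} \<subseteq> {1..} \<and> card {1..k} = k"
    by auto
  then have "sum_product_sizes k \<noteq> {}"
    unfolding sum_product_sizes_def by blast
  then show ?thesis
    unfolding g_def by (rule Inf_nat_def1)
qed

lemma g_le: "n \<in> sum_product_sizes k \<Longrightarrow> g k \<le> n"
  unfolding g_def by (rule wellorder_Inf_le1)

text \<open>Finiteness of the two sets, so that their \<open>card\<close> is not the default value 0.\<close>

lemma simple_sum_set_eq:
  assumes "finite A"
  shows "simple_sum_set A = (\<lambda>B. \<Sum>B) ` Pow A"
proof (intro equalityI subsetI)
  fix x assume "x \<in> simple_sum_set A"
  then obtain \<epsilon> :: "nat \<Rightarrow> nat" where e: "\<forall>a\<in>A. \<epsilon> a \<in> {0, 1}" and x: "x = (\<Sum>a\<in>A. \<epsilon> a * a)"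
    unfolding simple_sum_set_def by blast
  have "x = (\<Sum>a\<in>A. if \<epsilon> a = 1 then a else 0)"
    unfolding x using e by (intro sum.cong) auto
  also have "\<dots> = \<Sum>{a\<in>A. \<epsilon> a = 1}"
    using assms by (simp add: sum.inter_filter)
  finally show "x \<in> (\<lambda>B. \<Sum>B) ` Pow A" by blast
next
  fix x assume "x \<in> (\<lambda>B. \<Sum>B) ` Pow A"
  then obtain B where B: "B \<subseteq> A" and x: "x = \<Sum>B" by blast
  have "x = (\<Sum>a\<in>A. (if a \<in> B then 1 else 0) * a)"
    unfolding x using assms B by (intro sum.mono_neutral_cong_left) auto
  then show "x \<in> simple_sum_set A"
    unfolding simple_sum_set_def by (intro CollectI exI[of _ "\<lambda>a. if a \<in> B then 1 else 0"]) auto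
qed

lemma simple_product_set_eq:
  assumes "finite A"
  shows "simple_product_set A = (\<lambda>B. \<Prod>B) ` Pow A"
proof (intro equalityI subsetI)
  fix x assume "x \<in> simple_product_set A"
  then obtain \<epsilon> :: "nat \<Rightarrow> nat" where e: "\<forall>a\<in>A. \<epsilon> a \<in> {0, 1}" and x: "x = (\<Prod>a\<in>A. a ^ \<epsilon> a)"
    unfolding simple_product_set_def by blast
  have "x = (\<Prod>a\<in>A. if \<epsilon> a = 1 then a else 1)"
    unfolding x using e by (intro prod.cong) auto
  also have "\<dots> = \<Prod>{a\<in>A. \<epsilon> a = 1}"
    using assms by (simp add: prod.inter_filter)
  finally show "x \<in> (\<lambda>B. \<Prod>B) ` Pow A" by blast
next
  fix x assume "x \<in> (\<lambda>B. \<Prod>B) ` Pow A"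
  then obtain B where B: "B \<subseteq> A" and x: "x = \<Prod>B" by blast
  have "x = (\<Prod>a\<in>A. a ^ (if a \<in> B then 1 else 0))"
    unfolding x using assms B by (intro prod.mono_neutral_cong_left) auto
  then show "x \<in> simple_product_set A"
    unfolding simple_product_set_def
    by (intro CollectI exI[of _ "\<lambda>a. if a \<in> B then 1 else 0"]) auto
qed

lemma finite_simple_sets:
  assumes "finite A"
  shows "finite (simple_sum_set A)" "finite (simple_product_set A)"
  using assms by (simp_all add: simple_sum_set_eq simple_product_set_eq)

end

theory Submission
  imports Defs "HOL-Computational_Algebra.Primes" "HOL-Library.FuncSet" "HOL-Real_Asymp.Real_Asymp"
begin

text \<open>
  Lower bound. Numbers with pairwise distinct \<open>p\<close>-adic valuations have pairwise distinct subset
  sums, so either \<open>A[1]\<close> has at least \<open>2 ^ d\<close> elements or every prime takes at most \<open>d\<close> valuations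
  on \<open>A\<close>. In the latter case let \<open>C\<close> be a largest fibre of the \<open>p\<close>-adic valuation on \<open>A\<close>. If \<open>n\<close>
  elements lie outside \<open>C\<close>, pair them with \<open>n\<close> elements of \<open>C\<close>: taking one element of each pair
  realises \<open>n + 1\<close> valuations, while products of equally many elements of the rest of \<open>C\<close> all have
  the same valuation. So the number of products gains a factor \<open>n + 1\<close>, and the argument continues
  in the rest of \<open>C\<close>, which is smaller by a factor of at most \<open>2 * d\<close>. If for every prime fewer than
  \<open>n\<close> elements lie outside some fibre, then \<open>d\<close> such steps with a single pair cost few elements and
  give \<open>2 ^ d\<close> products. With \<open>x = ln k\<close>, take \<open>d\<close> about \<open>x\<^sup>2\<close> and
  \<open>x / (4 * ln x)\<close> steps, each with \<open>n\<close> about \<open>k powr (1/2)\<close>.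

  Upper bound. Take \<open>k\<close> numbers composed of \<open>m\<close> primes below \<open>2 * m\<^sup>2\<close> with exponents below \<open>h\<close>,
  where \<open>h\<close> is about \<open>x / (ln x) ^ 3\<close> and \<open>h ^ m\<close> is just above \<open>k\<close>.
\<close>

subsection \<open>Many subset sums or many subset products\<close>

text \<open>Let \<open>x\<close> have the least valuation. All sums of the other elements are
  divisible by the prime power \<open>q\<close>, which does not divide \<open>x\<close>, so adding
  \<open>x\<close> gives a disjoint translate of them. Each element thus doubles the number of
  sums.\<close>

lemma pow_card_le_subset_sums:
  fixes T :: "nat set"
  assumes "prime p" "finite T" "0 \<notin> T" "inj_on (multiplicity p) T"
  shows "2 ^ card T \<le> card ((\<lambda>B. \<Sum>B) ` Pow T)"
  using assms(2-)
proof (induction "card T" arbitrary: T)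
  case 0
  then show ?case by simp
next
  case (Suc n)
  have ne: "T \<noteq> {}" using Suc.hyps(2) by auto
  obtain x where x: "x \<in> T" and xmin: "\<And>y. y \<in> T \<Longrightarrow> multiplicity p x \<le> multiplicity p y"
    using arg_min_if_finite(1)[OF Suc.prems(1) ne, of "multiplicity p"]
      arg_min_least[OF Suc.prems(1) ne, of _ "multiplicity p"] by blast
  define T' where "T' = T - {x}"
  have T: "T = insert x T'" "x \<notin> T'" "finite T'" using x Suc.prems by (auto simp: T'_def)
  define q where "q = p ^ Suc (multiplicity p x)"
  have dv: "q dvd y" if "y \<in> T'" for y
  proof -
    have "multiplicity p x \<noteq> multiplicity p y"
      using that Suc.prems(3) T x by (metis T'_def Diff_iff inj_onD singletonI)
    then have "Suc (multiplicity p x) \<le> multiplicity p y"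
      using xmin[of y] that T by simp
    then show ?thesis unfolding q_def by (rule multiplicity_dvd')
  qed
  have x0: "x \<noteq> 0" using x Suc.prems by metis
  have ndv: "\<not> q dvd x"
    unfolding q_def using x0 assms(1)
    by (subst power_dvd_iff_le_multiplicity) (auto dest: not_prime_unit)
  define U where "U = (\<lambda>B. \<Sum>B) ` Pow T'"
  have dvS: "q dvd s" if "s \<in> U" for s using that dv unfolding U_def by (auto intro!: dvd_sum)
  have "(+) x ` U \<subseteq> (\<lambda>B. \<Sum>B) ` Pow T"
    unfolding U_def
  proof clarify
    fix B assume "B \<subseteq> T'"
    then have "x + \<Sum>B = \<Sum>(insert x B)" using T finite_subset by (subst sum.insert) auto
    then show "x + \<Sum>B \<in> (\<lambda>B. \<Sum>B) ` Pow T" using \<open>B \<subseteq> T'\<close> T by blast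
  qed
  moreover have "U \<subseteq> (\<lambda>B. \<Sum>B) ` Pow T" unfolding U_def using T by (intro image_mono) auto
  ultimately have sub: "U \<union> (+) x ` U \<subseteq> (\<lambda>B. \<Sum>B) ` Pow T" by blast
  have disj: "U \<inter> (+) x ` U = {}"
  proof -
    have "x + s \<notin> U" if "s \<in> U" for s
      using dvS[OF that] dvS[of "x + s"] ndv by (metis dvd_add_left_iff)
    then show ?thesis by (metis (no_types, lifting) disjoint_iff image_iff)
  qed
  have fin: "finite U" unfolding U_def using T by simp
  have "2 ^ card T' \<le> card U"
    unfolding U_def using Suc.hyps Suc.prems T by (intro Suc.hyps) (auto simp: inj_on_insert)
  moreover have "card (U \<union> (+) x ` U) = 2 * card U"
    using fin disj by (subst card_Un_disjoint) (auto simp: card_image)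
  moreover have "card (U \<union> (+) x ` U) \<le> card ((\<lambda>B. \<Sum>B) ` Pow T)"
    using sub Suc.prems by (intro card_mono) auto
  ultimately show ?case using T by simp
qed

lemma pow_card_valuations_le_simple_sum_set:
  assumes "prime p" "finite A" "0 \<notin> A"
  shows "2 ^ card (multiplicity p ` A) \<le> card (simple_sum_set A)"
proof -
  obtain T where T: "T \<subseteq> A" "inj_on (multiplicity p) T" "multiplicity p ` A = multiplicity p ` T"
    using subset_image_inj[of "multiplicity p ` A" "multiplicity p" A] by blast
  have "2 ^ card T \<le> card ((\<lambda>B. \<Sum>B) ` Pow T)"
    using assms T finite_subset by (intro pow_card_le_subset_sums) auto
  also have "\<dots> \<le> card ((\<lambda>B. \<Sum>B) ` Pow A)"
    using assms T by (intro card_mono image_mono) auto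
  finally show ?thesis using assms T by (simp add: simple_sum_set_eq card_image)
qed

section \<open>Products of subsets of a fixed size\<close>

text \<open>The number \<open>j\<close> of factors is fixed so that, inside one fibre of a
  valuation, all these products have the same valuation.\<close>

definition subset_products :: "nat \<Rightarrow> nat set \<Rightarrow> nat set" where
  "subset_products j B = (\<lambda>S. \<Prod>S) ` {S. S \<subseteq> B \<and> card S = j}"

lemma finite_subset_products: "finite B \<Longrightarrow> finite (subset_products j B)"
  unfolding subset_products_def by (intro finite_imageI) simp

lemma subset_products_0: "finite B \<Longrightarrow> subset_products 0 B = {1}"
proof -
  assume "finite B"
  then have "{S. S \<subseteq> B \<and> card S = 0} = {{}}" by (auto dest: finite_subset)
  then show ?thesis by (simp add: subset_products_def)
qed

lemma subset_products_nonzero: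
  assumes "0 \<notin> B" "finite B" "q \<in> subset_products j B"
  shows "q \<noteq> 0"
proof -
  obtain S where "S \<subseteq> B" "q = \<Prod>S" using assms(3) unfolding subset_products_def by auto
  moreover from this have "finite S" "0 \<notin> S" using assms(1,2) finite_subset by blast+
  ultimately show ?thesis by (simp only: prod_zero_iff) simp
qed

lemma mult_in_subset_products:
  assumes "finite B" "c \<in> subset_products i C" "q \<in> subset_products j D" "C \<inter> D = {}" "C \<union> D \<subseteq> B"
  shows "c * q \<in> subset_products (i + j) B"
proof -
  obtain S S' where S: "S \<subseteq> C" "card S = i" "c = \<Prod>S" "S' \<subseteq> D" "card S' = j" "q = \<Prod>S'"
    using assms unfolding subset_products_def by auto
  have fin: "finite S" "finite S'" "S \<inter> S' = {}"
    using S assms finite_subset[of S B] finite_subset[of S' B] by auto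
  have "c * q = \<Prod>(S \<union> S')" "card (S \<union> S') = i + j"
    using S fin by (simp_all add: prod.union_disjoint card_Un_disjoint)
  moreover have "S \<union> S' \<subseteq> B" using S assms by auto
  ultimately show ?thesis unfolding subset_products_def by blast
qed

lemma card_two_translates:
  fixes R :: "nat set"
  assumes "finite R" "R \<noteq> {}" "a \<noteq> b"
  shows "card R + 1 \<le> card ((+) a ` R \<union> (+) b ` R)"
proof -
  have *: "card R + 1 \<le> card ((+) a ` R \<union> (+) b ` R)" if "a < b" for a b
  proof -
    \<comment> \<open>The maximum of the larger translate lies beyond the whole smaller one.\<close>
    have "b + Max R \<notin> (+) a ` R" using Max_ge[OF assms(1)] that by fastforce
    then have "card R + 1 = card (insert (b + Max R) ((+) a ` R))"
      using assms by (simp add: card_image)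
    also have "\<dots> \<le> card ((+) a ` R \<union> (+) b ` R)"
      using assms by (intro card_mono) auto
    finally show ?thesis .
  qed
  show ?thesis using *[of a b] *[of b a] assms(3) by (cases "a < b") (auto simp: Un_commute)
qed

text \<open>Set aside one \<open>x\<close> from \<open>E\<close> and one \<open>y\<close> from
  \<open>D\<close>. Multiplying the remaining products by \<open>x\<close> or by \<open>y\<close>
  shifts their set of valuations by two different amounts, and the union of two distinct translates
  has at least one more element. So each pair contributes one new valuation.\<close>

lemma card_valuations_exchange:
  assumes "prime p" "finite E" "finite D" "card E = n" "card D = n" "0 \<notin> E \<union> D"
    and "\<And>x. x \<in> E \<Longrightarrow> multiplicity p x \<noteq> v" "\<And>y. y \<in> D \<Longrightarrow> multiplicity p y = v"
  shows "n + 1 \<le> card (multiplicity p ` subset_products n (E \<union> D))"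
  using assms(2-)
proof (induction n arbitrary: E D)
  case 0
  then show ?case by (simp add: subset_products_0)
next
  case (Suc n)
  obtain x y where x: "x \<in> E" and y: "y \<in> D" using Suc.prems by fastforce
  define E' D' where "E' = E - {x}" and "D' = D - {y}"
  define R where "R = multiplicity p ` subset_products n (E' \<union> D')"
  have ED: "E \<inter> D = {}" using Suc.prems by auto
  have IH: "n + 1 \<le> card R"
    unfolding R_def using Suc.prems x y by (intro Suc.IH) (auto simp: E'_def D'_def)
  have "finite R" unfolding R_def using Suc.prems
    by (intro finite_imageI finite_subset_products) (auto simp: E'_def D'_def)
  moreover have "R \<noteq> {}" using IH by auto
  ultimately have "n + 2 \<le> card ((+) (multiplicity p x) ` R \<union> (+) (multiplicity p y) ` R)"
    using card_two_translates[of R "multiplicity p x" "multiplicity p y"] Suc.prems x y IH by fastforce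
  also have "\<dots> \<le> card (multiplicity p ` subset_products (Suc n) (E \<union> D))"
  proof (intro card_mono)
    show "finite (multiplicity p ` subset_products (Suc n) (E \<union> D))"
      using Suc.prems by (intro finite_imageI finite_subset_products) auto
    have "multiplicity p z + r \<in> multiplicity p ` subset_products (Suc n) (E \<union> D)"
      if "z \<in> {x, y}" "r \<in> R" for z r
    proof -
      obtain c where c: "c \<in> subset_products n (E' \<union> D')" "r = multiplicity p c"
        using \<open>r \<in> R\<close> unfolding R_def by blast
      have "z \<in> subset_products 1 {z}"
        unfolding subset_products_def by (auto intro!: image_eqI[of _ _ "{z}"])
      then have "z * c \<in> subset_products (1 + n) (E \<union> D)"
        using c that(1) x y ED Suc.prems(1,2)
        by (intro mult_in_subset_products[of _ z 1 "{z}" c n "E' \<union> D'"]) (auto simp: E'_def D'_def)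
      moreover have "c \<noteq> 0"
        by (rule subset_products_nonzero[OF _ _ c(1)]) (use Suc.prems in \<open>auto simp: E'_def D'_def\<close>)
      then have "multiplicity p (z * c) = multiplicity p z + r"
        using assms(1) that(1) x y Suc.prems(5) c(2)
        by (subst prime_elem_multiplicity_mult_distrib) (auto intro!: Nat.gr0I)
      ultimately show ?thesis by (metis image_eqI plus_1_eq_Suc)
    qed
    then show "(+) (multiplicity p x) ` R \<union> (+) (multiplicity p y) ` R
        \<subseteq> multiplicity p ` subset_products (Suc n) (E \<union> D)" by blast
  qed
  finally show ?case by simp
qed

lemma multiplicity_subset_products_const:
  assumes "prime p" "finite B" "0 \<notin> B" "\<And>b. b \<in> B \<Longrightarrow> multiplicity p b = v" "q \<in> subset_products j B"
  shows "multiplicity p q = j * v"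
proof -
  obtain S where S: "S \<subseteq> B" "card S = j" "q = \<Prod>S"
    using assms(5) unfolding subset_products_def by auto
  have "multiplicity p q = (\<Sum>b\<in>S. multiplicity p b)"
    unfolding S(3) using assms S
    by (intro prime_elem_multiplicity_prod_distrib) (auto intro: finite_subset)
  also have "\<dots> = (\<Sum>b\<in>S. v)" using assms S by (intro sum.cong) auto
  finally show ?thesis using S by simp
qed

text \<open>Every product \<open>q\<close> from \<open>B'\<close> has valuation
  \<open>j * v\<close>, so the valuation of \<open>c r * q\<close> reveals \<open>r\<close>;
  cancelling \<open>c r\<close> then reveals \<open>q\<close>. Hence the map from pairs to products
  is injective.\<close>

lemma card_subset_products_exchange:
  assumes "prime p" "finite B" "0 \<notin> B" "E \<subseteq> B" "D \<subseteq> B" "B' \<subseteq> B" "D \<inter> B' = {}"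
    and "card E = n" "card D = n"
    and E: "\<And>x. x \<in> E \<Longrightarrow> multiplicity p x \<noteq> v"
    and D: "\<And>y. y \<in> D \<union> B' \<Longrightarrow> multiplicity p y = v"
  shows "(n + 1) * card (subset_products j B') \<le> card (subset_products (n + j) B)"
proof -
  have fin: "finite E" "finite D" "finite B'" using assms by (auto intro: finite_subset)
  let ?P = "subset_products n (E \<union> D)" and ?Q = "subset_products j B'"
  let ?R = "multiplicity p ` ?P"
  have R: "n + 1 \<le> card ?R"
    using assms fin by (intro card_valuations_exchange[of p E D n v]) auto
  define c where "c = inv_into ?P (multiplicity p)"
  have c: "c r \<in> ?P" "multiplicity p (c r) = r" if "r \<in> ?R" for r
    using that by (auto simp: c_def inv_into_into f_inv_into_f)
  have c0: "c r \<noteq> 0" if "r \<in> ?R" for r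
    by (rule subset_products_nonzero[OF _ _ c(1)[OF that]]) (use assms fin in auto)
  have q0: "q \<noteq> 0" if "q \<in> ?Q" for q
    by (rule subset_products_nonzero[OF _ _ that]) (use assms fin in auto)
  have val: "multiplicity p (c r * q) = r + j * v" if "r \<in> ?R" "q \<in> ?Q" for r q
  proof -
    have "multiplicity p q = j * v"
      by (rule multiplicity_subset_products_const[OF assms(1) fin(3) _ _ that(2)]) (use assms in auto)
    then show ?thesis using assms(1) c0[OF that(1)] q0[OF that(2)] c(2)[OF that(1)]
      by (subst prime_elem_multiplicity_mult_distrib) auto
  qed
  have "inj_on (\<lambda>(r, q). c r * q) (?R \<times> ?Q)"
  proof (rule inj_onI, elim SigmaE, simp only: prod.case prod.inject)
    fix r q r' q'
    assume a: "r \<in> ?R" "q \<in> ?Q" "r' \<in> ?R" "q' \<in> ?Q" "c r * q = c r' * q'"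
    have "r = r'" using val[OF a(1,2)] val[OF a(3,4)] a(5) by simp
    then show "r = r' \<and> q = q'" using a(5) c0[OF a(1)] by simp
  qed
  moreover have "(\<lambda>(r, q). c r * q) ` (?R \<times> ?Q) \<subseteq> subset_products (n + j) B"
  proof (intro image_subsetI, elim SigmaE, simp only: prod.case)
    fix r q assume rq: "r \<in> ?R" "q \<in> ?Q"
    have "(E \<union> D) \<inter> B' = {}" using assms(7) E D by blast
    then show "c r * q \<in> subset_products (n + j) B"
      using assms(4,5,6) by (intro mult_in_subset_products[OF assms(2) c(1)[OF rq(1)] rq(2)]) auto
  qed
  ultimately have "card (?R \<times> ?Q) \<le> card (subset_products (n + j) B)"
    using finite_subset_products[OF assms(2)] by (rule card_inj_on_le)
  moreover have "(n + 1) * card ?Q \<le> card (?R \<times> ?Q)"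
    using R by (simp only: card_cartesian_product mult_le_mono1)
  ultimately show ?thesis by linarith
qed

text \<open>Each step discards the exceptional set \<open>E\<close> of one prime, with at most
  \<open>n - 1\<close> elements, and one more element \<open>d\<close>. It costs at most
  \<open>n\<close> elements and doubles the number of products, by exchanging \<open>d\<close> with
  one exceptional \<open>e\<close>.\<close>

lemma subset_products_concentrated:
  assumes "finite B" "0 \<notin> B"
    and conc: "\<And>p. prime p \<Longrightarrow> \<exists>v. card {b \<in> B. multiplicity p b \<noteq> v} < n"
    and "B' \<subseteq> B" "i * n < card B'"
  shows "\<exists>j. 2 ^ i \<le> card (subset_products j B')"
  using assms(4-)
proof (induction i arbitrary: B')
  case 0
  then have "finite B'" using assms finite_subset by blast
  then show ?case by (intro exI[of _ 0]) (simp add: subset_products_0)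
next
  case (Suc i)
  have fin: "finite B'" using assms Suc.prems finite_subset by blast
  have "n \<noteq> 0" using conc[OF two_is_prime_nat] by auto
  then have "1 < card B'" using Suc.prems(2) by simp
  then obtain x y where xy: "x \<in> B'" "y \<in> B'" "x \<noteq> y"
    by (metis One_nat_def card_le_Suc0_iff_eq[OF fin] not_less)
  \<comment> \<open>Distinct positive integers differ in their valuation at some prime; at most one
    of \<open>x\<close> and \<open>y\<close> can then have the typical valuation \<open>v\<close>,
    so \<open>E\<close> is not empty.\<close>
  obtain p where p: "prime p" "multiplicity p x \<noteq> multiplicity p y"
    using multiplicity_eq_nat[of x y] xy Suc.prems(1) assms(2) by (metis gr0I subsetD)
  obtain v where v: "card {b \<in> B. multiplicity p b \<noteq> v} < n" using conc[OF p(1)] by blast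
  define E where "E = {b \<in> B'. multiplicity p b \<noteq> v}"
  have "card E \<le> card {b \<in> B. multiplicity p b \<noteq> v}"
    unfolding E_def using assms Suc.prems by (intro card_mono) auto
  then have cE: "card E < n" using v by simp
  obtain e where e: "e \<in> E" using p(2) xy unfolding E_def by fastforce
  have cC: "card (B' - E) = card B' - card E"
    using fin by (intro card_Diff_subset) (auto simp: E_def)
  then have gt: "i * n + 1 < card (B' - E)" using Suc.prems(2) cE by simp
  then obtain d where d: "d \<in> B' - E" by (metis card.empty ex_in_conv not_less_zero)
  have "i * n < card (B' - E - {d})" using gt d fin by simp
  then obtain j where j: "2 ^ i \<le> card (subset_products j (B' - E - {d}))"
    using Suc.IH[of "B' - E - {d}"] Suc.prems by blast
  have "(1 + 1) * card (subset_products j (B' - E - {d})) \<le> card (subset_products (1 + j) B')"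
    using p fin e d assms(2) Suc.prems
    by (intro card_subset_products_exchange[of p B' "{e}" "{d}" _ 1 v]) (auto simp: E_def)
  then show ?case using j by (intro exI[of _ "1 + j"]) simp
qed

text \<open>The pigeonhole principle, multiplied out to avoid dividing by \<open>d\<close>.\<close>

lemma exists_large_fibre:
  assumes "finite B" "card (f ` B) \<le> d"
  shows "\<exists>v. card B \<le> d * card {b \<in> B. f b = v}"
proof (rule ccontr)
  assume "\<not> ?thesis"
  then have less: "d * card {b \<in> B. f b = v} < card B" for v by (simp add: not_le)
  have "B \<noteq> {}" using less[of undefined] by auto
  have "d * card B = (\<Sum>v\<in>f ` B. d * card {b \<in> B. f b = v})"
    using sum.image_gen[OF assms(1), of "\<lambda>_. 1::nat" f]
    by (simp add: sum_distrib_left)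
  also have "\<dots> < (\<Sum>v\<in>f ` B. card B)"
    using less assms \<open>B \<noteq> {}\<close> by (intro sum_strict_mono) auto
  also have "\<dots> \<le> d * card B" using assms(2) by simp
  finally show False by simp
qed

text \<open>The minimum reflects the two ways the iteration can end: all \<open>s\<close> steps gain
  a factor \<open>n + 1\<close>, or concentration at every prime yields \<open>2 ^ d\<close> at
  once. In \<open>(2 * d) ^ s\<close> each factor \<open>d\<close> pays for passing to a largest
  fibre, and each 2 for removing \<open>n\<close> of its elements.\<close>

lemma subset_products_lower_bound:
  assumes "finite B" "0 \<notin> B" "0 < n"
    and "\<And>p. prime p \<Longrightarrow> card (multiplicity p ` B) \<le> d"
    and "n * (2 * d) ^ s \<le> card B"
  shows "\<exists>j. min (2 ^ d) ((n + 1) ^ s) \<le> card (subset_products j B)"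
  using assms(1,2,4,5)
proof (induction s arbitrary: B)
  case 0
  then show ?case by (intro exI[of _ 0]) (simp add: subset_products_0)
next
  case (Suc s)
  show ?case
  proof (cases "d = 0 \<or> (\<forall>p. prime p \<longrightarrow> (\<exists>v. card {b \<in> B. multiplicity p b \<noteq> v} < n))")
    case True
    show ?thesis
    proof (cases "d = 0")
      case True
      \<comment> \<open>Here the minimum is at most \<open>2 ^ 0 = 1\<close>, which the empty
        product attains.\<close>
      then show ?thesis using Suc.prems by (intro exI[of _ 0]) (simp add: subset_products_0)
    next
      case d: False
      have "n * (2 * d) * 1 \<le> n * (2 * d) * (2 * d) ^ s" using d by (intro mult_le_mono) auto
      also have "\<dots> \<le> card B" using Suc.prems(4) by (simp only: power_Suc mult.assoc)
      finally have "2 * d * n \<le> card B" by (simp only: mult.commute mult.left_commute mult_1_right)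
      moreover have "d * n < 2 * d * n" using d assms(3) by simp
      ultimately have "d * n < card B" by linarith
      then have "\<exists>j. 2 ^ d \<le> card (subset_products j B)"
        using True d Suc.prems by (intro subset_products_concentrated[of B n B d]) auto
      then show ?thesis by (meson min.coboundedI1)
    qed
  next
    case False
    then obtain p where p: "prime p" and big: "\<And>v. n \<le> card {b \<in> B. multiplicity p b \<noteq> v}"
      and d: "d > 0" by (auto simp: not_less)
    obtain v where v: "card B \<le> d * card {b \<in> B. multiplicity p b = v}"
      using exists_large_fibre[OF Suc.prems(1) Suc.prems(3)[OF p]] by blast
    define C where "C = {b \<in> B. multiplicity p b = v}"
    have "d * (2 * n * (2 * d) ^ s) \<le> d * card C"
      using order_trans[OF Suc.prems(4) v] unfolding C_def[symmetric] power_Suc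
      by (simp only: mult.assoc mult.commute mult.left_commute)
    then have C: "2 * n * (2 * d) ^ s \<le> card C" using d by simp
    moreover have "2 * n * 1 \<le> 2 * n * (2 * d) ^ s" using d by (intro mult_le_mono) auto
    ultimately have C2: "2 * n \<le> card C" by linarith
    obtain D where D: "D \<subseteq> C" "card D = n" using C2 obtain_subset_with_card_n[of n C] by auto
    obtain E where E: "E \<subseteq> {b \<in> B. multiplicity p b \<noteq> v}" "card E = n"
      using big[of v] obtain_subset_with_card_n by metis
    have finC: "finite C" using Suc.prems by (simp add: C_def)
    have "card (C - D) = card C - n" using D finC by (metis card_Diff_subset finite_subset)
    moreover have "n * (2 * d) ^ s \<ge> n * 1" using d by (intro mult_le_mono) auto
    ultimately have cCD: "n * (2 * d) ^ s \<le> card (C - D)" using C by linarith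
    have "card (multiplicity q ` (C - D)) \<le> d" if "prime q" for q
      using Suc.prems(1) by (intro order_trans[OF card_mono Suc.prems(3)[OF that]]) (auto simp: C_def)
    then obtain j where j: "min (2 ^ d) ((n + 1) ^ s) \<le> card (subset_products j (C - D))"
      using Suc.IH[of "C - D", OF _ _ _ cCD] finC Suc.prems(2) unfolding C_def by blast
    have "min (2 ^ d) ((n + 1) ^ Suc s) \<le> (n + 1) * min (2 ^ d) ((n + 1) ^ s)"
    proof (cases "(2::nat) ^ d \<le> (n + 1) ^ s")
      case True
      then have "min (2 ^ d) ((n + 1) ^ s) = (2::nat) ^ d" by (rule min_absorb1)
      then show ?thesis by (simp add: min.coboundedI1)
    next
      case False
      then have "min (2 ^ d) ((n + 1) ^ s) = (n + 1) ^ s" by simp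
      then show ?thesis by (simp only: power_Suc min.cobounded2)
    qed
    also have "\<dots> \<le> (n + 1) * card (subset_products j (C - D))" using j by (intro mult_le_mono2)
    also have "\<dots> \<le> card (subset_products (n + j) B)"
      by (rule card_subset_products_exchange[OF p Suc.prems(1,2), of E D _ _ v])
        (use E D in \<open>auto simp: C_def\<close>)
    finally show ?thesis by blast
  qed
qed

section \<open>Lower bound for \<open>g\<close> with free parameters\<close>

lemma g_lower_bound:
  assumes "0 < n" "n * (2 * d) ^ s \<le> k"
  shows "min (2 ^ d) ((n + 1) ^ s) \<le> g k"
proof -
  obtain A where A: "finite A" "A \<subseteq> {1..}" "card A = k"
    and g: "g k = card (simple_sum_set A) + card (simple_product_set A)"
    using g_mem[of k] unfolding sum_product_sizes_def by blast
  have A0: "0 \<notin> A" using A(2) by auto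
  show ?thesis
  proof (cases "\<exists>p. prime p \<and> d < card (multiplicity p ` A)")
    case True
    then obtain p where p: "prime p" "d < card (multiplicity p ` A)" by blast
    have "(2::nat) ^ d \<le> 2 ^ card (multiplicity p ` A)" using p by (intro power_increasing) auto
    also have "\<dots> \<le> g k" using pow_card_valuations_le_simple_sum_set[OF p(1) A(1) A0] g by simp
    finally show ?thesis by simp
  next
    case False
    then obtain j where j: "min (2 ^ d) ((n + 1) ^ s) \<le> card (subset_products j A)"
      using subset_products_lower_bound[OF A(1) A0 assms(1), of d s] assms(2) A(3)
      by (auto simp: not_less)
    also have "\<dots> \<le> card (simple_product_set A)"
      using A by (intro card_mono) (auto simp: subset_products_def simple_product_set_eq)
    finally show ?thesis using g by simp
  qed
qed

subsection \<open>Smooth numbers\<close>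

text \<open>
  Every entry \<open>1 / (k * (n choose k))\<close> of Leibniz' harmonic triangle is an integer combination of
  \<open>1, 1/2, \<dots>, 1/n\<close>. Hence \<open>n * ((2 * n) choose n)\<close> bounds the least common multiple of
  \<open>1, \<dots>, 2 * n\<close> from below, which yields a Chebyshev-type bound for the number of primes.
\<close>

lemma Leibniz_triangle_Ints:
  assumes "Suc k \<le> n" "\<And>i. 0 < i \<Longrightarrow> i \<le> n \<Longrightarrow> i dvd D"
  shows "real D / (real (Suc k) * real (n choose Suc k)) \<in> \<int>"
  using assms
proof (induction k arbitrary: n)
  case 0
  then have "n dvd D" by simp
  then obtain c where "D = n * c" by (rule dvdE)
  then show ?case using 0 by simp
next
  case (Suc k)
  obtain m where n: "n = Suc m" using Suc.prems by (cases n) auto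
  define a b c where "a = real (m choose Suc k)" and "b = real (n choose Suc k)"
    and "c = real (m choose k)"
  have pos: "a > 0" "b > 0" "c > 0" using Suc.prems(1) n
    unfolding a_def b_def c_def of_nat_0_less_iff by (auto intro!: zero_less_binomial)
  have b: "b = a + c" unfolding a_def b_def c_def n by simp
  have "real (Suc k * (n choose Suc k)) = real (n * (m choose k))"
    unfolding n by (subst Suc_times_binomial) simp
  then have kb: "real (Suc k) * b = real n * c" by (simp only: b_def c_def of_nat_mult)
  have na: "real (Suc (Suc k)) * real (n choose Suc (Suc k)) = real n * a"
    unfolding a_def n by (subst of_nat_mult[symmetric], subst Suc_times_binomial) (simp only: of_nat_mult)
  \<comment> \<open>The recurrence of the harmonic triangle: an entry is the difference of two
    entries with a smaller lower index, in rows \<open>m\<close> and \<open>n\<close>. Both fall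
    under the induction hypothesis because \<open>n\<close> is arbitrary.\<close>
  have "real D / (real (Suc k) * a) - real D / (real (Suc k) * b)
      = real D * (b - a) / (a * (real (Suc k) * b))"
    using pos by (simp add: field_simps del: of_nat_Suc)
  also have "\<dots> = real D / (real n * a)"
    unfolding kb using pos b n by (simp add: field_simps del: of_nat_Suc)
  finally have eq: "real D / (real n * a)
      = real D / (real (Suc k) * a) - real D / (real (Suc k) * b)" by simp
  show ?case unfolding na eq unfolding a_def b_def
    using Suc.prems n by (intro Ints_diff Suc.IH) auto
qed

text \<open>\<open>D\<close> times the entry of the harmonic triangle is a positive integer, hence
  at least 1.\<close>

lemma mult_central_binomial_le_common_multiple:
  assumes "0 < n" "0 < D" "\<And>i. 0 < i \<Longrightarrow> i \<le> 2 * n \<Longrightarrow> i dvd D"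
  shows "n * ((2 * n) choose n) \<le> D"
proof -
  have "real D / (real n * real ((2 * n) choose n)) \<in> \<int>"
    using Leibniz_triangle_Ints[of "n - 1" "2 * n" D] assms by simp
  then obtain z where z: "real D / (real n * real ((2 * n) choose n)) = of_int z" by (auto elim: Ints_cases)
  have pos: "0 < real n * real ((2 * n) choose n)" using assms by simp
  have "0 < real D / (real n * real ((2 * n) choose n))" using pos assms by simp
  then have "1 \<le> z" using z by simp
  then have "1 \<le> real D / (real n * real ((2 * n) choose n))" using z by simp
  then have "real (n * ((2 * n) choose n)) \<le> real D" using pos by (simp add: field_simps)
  then show ?thesis by (simp only: of_nat_le_iff)
qed

text \<open>The witness is the least common multiple: each prime up to \<open>N\<close> enters with
  its largest power not exceeding \<open>N\<close>, so every factor is at most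
  \<open>N\<close>.\<close>

lemma exists_common_multiple_le_power_card_primes:
  assumes "0 < (N::nat)"
  shows "\<exists>D. 0 < D \<and> (\<forall>i. 0 < i \<longrightarrow> i \<le> N \<longrightarrow> i dvd D) \<and> D \<le> N ^ card {p. prime p \<and> p \<le> N}"
proof -
  define Q where "Q = {p. prime p \<and> p \<le> N}"
  define e where "e p = (GREATEST e. p ^ e \<le> N)" for p
  define D where "D = (\<Prod>p\<in>Q. p ^ e p)"
  have finQ: "finite Q" unfolding Q_def by (rule finite_subset[of _ "{..N}"]) auto
  \<comment> \<open>Bounds the admissible exponents, so that \<open>GREATEST\<close> is
    attained.\<close>
  have bnd: "k \<le> N" if "prime p" "p ^ k \<le> N" for p k
  proof -
    have "k < 2 ^ k" by simp
    also have "\<dots> \<le> p ^ k" using that prime_ge_2_nat by (intro power_mono) auto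
    finally show ?thesis using that by simp
  qed
  have e1: "p ^ e p \<le> N" if "prime p" for p
    unfolding e_def 
    by (rule GreatestI_nat[of "\<lambda>e. p ^ e \<le> N" 0 N]) (use assms bnd[OF that] in auto)
  have e2: "k \<le> e p" if "prime p" "p ^ k \<le> N" for p k
    unfolding e_def 
    by (rule Greatest_le_nat[of "\<lambda>e. p ^ e \<le> N" k N]) (use that bnd[OF that(1)] in auto)
  have D0: "0 < D" unfolding D_def Q_def by (auto intro!: prod_pos dest: prime_gt_0_nat)
  have "D \<le> (\<Prod>p\<in>Q. N)" unfolding D_def by (intro prod_mono) (auto simp: Q_def e1)
  then have "D \<le> N ^ card Q" by simp
  moreover have "i dvd D" if i: "0 < i" "i \<le> N" for i
  proof (rule multiplicity_le_imp_dvd)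
    fix p :: nat assume p: "prime p"
    show "multiplicity p i \<le> multiplicity p D"
    proof (cases "p \<in> Q")
      case True
      have "p ^ multiplicity p i \<le> N"
        using i by (meson dvd_imp_le le_trans multiplicity_dvd)
      then have "multiplicity p i \<le> e p" by (rule e2[OF p])
      also have "\<dots> = multiplicity p D"
        unfolding D_def using True finQ p
        by (subst multiplicity_prod_prime_powers) (auto simp: Q_def)
      finally show ?thesis .
    next
      case False
      then have "\<not> p dvd i" using i p by (auto simp: Q_def dest: dvd_imp_le)
      then show ?thesis by (simp add: not_dvd_imp_multiplicity_0)
    qed
  qed (use i in auto)
  ultimately show ?thesis using D0 unfolding Q_def by blast
qed

text \<open>The inequality fails at 6; this is the source of the threshold 7 below.\<close>

lemma two_pow_gt_double_square: "7 \<le> m \<Longrightarrow> 2 * m ^ 2 < (2::nat) ^ m"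
proof (induction m rule: nat_induct_at_least)
  case (Suc m)
  have "2 * (Suc m) ^ 2 \<le> 2 * (2 * m ^ 2)"
  proof -
    have "7 * m \<le> m * m" using Suc.hyps by (rule mult_le_mono1)
    moreover have "2 * (Suc m * Suc m) = 2 * (m * m) + 4 * m + 2" by simp
    ultimately show ?thesis using Suc.hyps unfolding power2_eq_square by linarith
  qed
  also have "\<dots> < 2 ^ Suc m" using Suc.IH by simp
  finally show ?case .
qed simp

text \<open>With fewer than \<open>m\<close> primes up to \<open>2 * n\<close>, where
  \<open>n = m ^ 2\<close>, the common multiple \<open>D\<close> satisfies
  \<open>2 ^ n \<le> D \<le> (2 * n) ^ m\<close>, and taking \<open>m\<close>-th roots gives a
  contradiction. So crude a bound suffices because the size of the primes matters only through its
  logarithm.\<close>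

lemma card_primes_ge:
  assumes "7 \<le> m"
  shows "m \<le> card {p. prime p \<and> p \<le> 2 * m ^ 2}"
proof (rule ccontr)
  assume less: "\<not> ?thesis"
  define n where "n = m ^ 2"
  have n: "0 < n" using assms by (simp add: n_def)
  obtain D where D: "0 < D" "\<And>i. 0 < i \<Longrightarrow> i \<le> 2 * n \<Longrightarrow> i dvd D"
    "D \<le> (2 * n) ^ card {p. prime p \<and> p \<le> 2 * n}"
    using exists_common_multiple_le_power_card_primes[of "2 * n"] n by auto
  have "(2::real) ^ n * 2 \<le> 2 ^ n * 2 ^ n"
    using n power_increasing[of 1 n "2::real"] by (intro mult_left_mono) auto
  then have "(2::real) ^ n \<le> real n * (4 ^ n / (2 * real n))"
    using n by (simp add: power_mult_distrib[symmetric])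
  also have "\<dots> \<le> real n * real ((2 * n) choose n)"
    using central_binomial_lower_bound[OF n] by (intro mult_left_mono) auto
  finally have "real (2 ^ n) \<le> real (n * ((2 * n) choose n))" by simp
  then have "2 ^ n \<le> n * ((2 * n) choose n)" by (simp only: of_nat_le_iff)
  also have "\<dots> \<le> D" using n D by (intro mult_central_binomial_le_common_multiple) auto
  also have "\<dots> \<le> (2 * n) ^ m"
    using less n by (intro order_trans[OF D(3)] power_increasing) (auto simp: n_def)
  finally have "(2 ^ m) ^ m \<le> (2 * m ^ 2) ^ m"
    by (simp add: n_def power2_eq_square power_mult)
  then have "2 ^ m \<le> 2 * m ^ 2" using assms by (subst (asm) power_mono_iff) auto
  then show False using two_pow_gt_double_square[OF assms] by simp
qed

section \<open>Upper bound for \<open>g\<close> from smooth numbers\<close>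

lemma inj_on_prime_powers:
  assumes "finite Q" "\<And>p. p \<in> Q \<Longrightarrow> prime (p::nat)"
  shows "inj_on (\<lambda>e. \<Prod>p\<in>Q. p ^ e p) (Q \<rightarrow>\<^sub>E X)"
proof (rule inj_onI)
  fix e f assume ef: "e \<in> Q \<rightarrow>\<^sub>E X" "f \<in> Q \<rightarrow>\<^sub>E X" "(\<Prod>p\<in>Q. p ^ e p) = (\<Prod>p\<in>Q. p ^ f p)"
  have "e p = f p" if "p \<in> Q" for p
  proof -
    have "multiplicity p (\<Prod>p\<in>Q. p ^ e p) = multiplicity p (\<Prod>p\<in>Q. p ^ f p)" using ef(3) by simp
    then show ?thesis using that assms by (subst (asm) (1 2) multiplicity_prod_prime_powers) auto
  qed
  then show "e = f" using ef by (intro PiE_ext) auto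
qed

text \<open>Sums are bounded by \<open>k\<close> times the bound for the elements, with 1 added for
  the sum 0. Products are again composed of the \<open>m\<close> primes, with exponents below
  \<open>k * h\<close>, so their exponent vectors are counted.\<close>

lemma g_upper_bound:
  assumes "7 \<le> m" "k \<le> h ^ m" "0 < k" "0 < h"
  shows "g k \<le> k * (2 * m ^ 2) ^ (m * h) + 1 + (k * h) ^ m"
proof -
  define P where "P = 2 * m ^ 2"
  obtain Q where Q: "Q \<subseteq> {p. prime p \<and> p \<le> P}" "card Q = m"
    unfolding P_def using obtain_subset_with_card_n[OF card_primes_ge[OF assms(1)]] by blast
  have finQ: "finite Q" using Q assms(1) by (intro card_ge_0_finite) simp
  define val where "val e = (\<Prod>p\<in>Q. p ^ e p)" for e
  have "card (val ` (Q \<rightarrow>\<^sub>E {..<h})) = card (Q \<rightarrow>\<^sub>E {..<h})"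
    unfolding val_def using finQ Q by (intro card_image inj_on_prime_powers) auto
  also have "\<dots> = h ^ m" using finQ Q by (simp add: card_PiE)
  finally have "k \<le> card (val ` (Q \<rightarrow>\<^sub>E {..<h}))" using assms(2) by simp
  then obtain A where A: "A \<subseteq> val ` (Q \<rightarrow>\<^sub>E {..<h})" "card A = k"
    by (rule obtain_subset_with_card_n)
  have finA: "finite A" using A assms(3) by (intro card_ge_0_finite) simp
  have pos: "0 < val e" for e 
    unfolding val_def using Q prime_gt_0_nat by (intro prod_pos) (auto intro!: zero_less_power)
  have P0: "0 < P" using assms(1) by (simp add: P_def)
  have le: "a \<le> P ^ (m * h)" if a: "a \<in> A" for a
  proof -
    obtain e where e: "a = val e" "e \<in> Q \<rightarrow>\<^sub>E {..<h}" using a A(1) by blast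
    have "p ^ e p \<le> P ^ h" if "p \<in> Q" for p
    proof -
      have "p ^ e p \<le> P ^ e p" using that Q by (intro power_mono) auto
      also have "\<dots> \<le> P ^ h" using P0 PiE_mem[OF e(2) that] by (intro power_increasing) auto
      finally show ?thesis .
    qed
    then have "a \<le> (\<Prod>p\<in>Q. P ^ h)" unfolding e val_def by (intro prod_mono) auto
    then show ?thesis using Q by (simp add: power_mult[symmetric] mult.commute)
  qed
  have "simple_sum_set A \<subseteq> {..k * P ^ (m * h)}"
    unfolding simple_sum_set_eq[OF finA]
  proof (rule image_subsetI)
    fix B assume "B \<in> Pow A"
    then have B: "B \<subseteq> A" by simp
    have "\<Sum>B \<le> \<Sum>A" using B finA by (intro sum_mono2) auto
    also have "\<dots> \<le> k * P ^ (m * h)" using le A(2) sum_bounded_above[of A "\<lambda>a. a"] by simp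
    finally show "\<Sum>B \<in> {..k * P ^ (m * h)}" by simp
  qed
  then have "card (simple_sum_set A) \<le> card {..k * P ^ (m * h)}" by (intro card_mono) auto
  then have sums: "card (simple_sum_set A) \<le> k * P ^ (m * h) + 1" by simp
  have "simple_product_set A \<subseteq> val ` (Q \<rightarrow>\<^sub>E {..<k * h})"
    unfolding simple_product_set_eq[OF finA]
  proof (rule image_subsetI)
    fix B assume "B \<in> Pow A"
    then have B: "B \<subseteq> A" by simp
    have "\<exists>e. \<forall>b\<in>B. e b \<in> Q \<rightarrow>\<^sub>E {..<h} \<and> b = val (e b)" using B A by (intro bchoice) blast
    then obtain e where e: "\<And>b. b \<in> B \<Longrightarrow> e b \<in> Q \<rightarrow>\<^sub>E {..<h}" "\<And>b. b \<in> B \<Longrightarrow> b = val (e b)"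
      by blast
    define f where "f = restrict (\<lambda>p. \<Sum>b\<in>B. e b p) Q"
    have "\<Prod>B = (\<Prod>b\<in>B. \<Prod>p\<in>Q. p ^ e b p)"
      using e(2) by (intro prod.cong) (auto simp: val_def)
    also have "\<dots> = (\<Prod>p\<in>Q. \<Prod>b\<in>B. p ^ e b p)" by (rule prod.swap)
    also have "\<dots> = val f" unfolding val_def f_def by (intro prod.cong) (auto simp: power_sum)
    finally have eq: "\<Prod>B = val f" .
    have "(\<Sum>b\<in>B. e b p) < k * h" if "p \<in> Q" for p
    proof -
      \<comment> \<open>Exponents are at most \<open>h - 1\<close>, which makes the final bound
        strict.\<close>
      have "(\<Sum>b\<in>B. e b p) \<le> card B * (h - 1)"
        using PiE_mem[OF e(1) that] sum_bounded_above[of B "\<lambda>b. e b p" "h - 1"] assms(4) by fastforce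
      also have "\<dots> \<le> k * (h - 1)" using card_mono[OF finA B] A by (intro mult_le_mono1) simp
      also have "\<dots> < k * h" using assms(3,4) by simp
      finally show ?thesis .
    qed
    then have "f \<in> Q \<rightarrow>\<^sub>E {..<k * h}" unfolding f_def by auto
    then show "\<Prod>B \<in> val ` (Q \<rightarrow>\<^sub>E {..<k * h})" unfolding eq by blast
  qed
  then have "card (simple_product_set A) \<le> card (val ` (Q \<rightarrow>\<^sub>E {..<k * h}))"
    using finQ by (intro card_mono) (auto intro: finite_PiE)
  also have "\<dots> \<le> card (Q \<rightarrow>\<^sub>E {..<k * h})" using finQ by (intro card_image_le finite_PiE) auto
  also have "\<dots> = (k * h) ^ m" using finQ Q by (simp add: card_PiE)
  finally have prods: "card (simple_product_set A) \<le> (k * h) ^ m" .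
  have "A \<subseteq> {1..}" using A pos by (auto simp: Suc_le_eq)
  then have "g k \<le> card (simple_sum_set A) + card (simple_product_set A)"
    using finA A(2) by (intro g_le) (auto simp: sum_product_sizes_def)
  then show ?thesis using sums prods unfolding P_def by linarith
qed

subsection \<open>Asymptotics\<close>

text \<open>\<open>F1\<close> serves the term \<open>2 ^ d\<close> and \<open>F2\<close> the term
  \<open>(n + 1) ^ s\<close>. With \<open>c * x / ln x\<close> steps the latter has logarithm about
  \<open>c * (1 - 2 * c) * x ^ 2 / ln x\<close>; the best choice \<open>c = 1/4\<close> gives the
  constant 1/8.\<close>

lemma g_gt_exp:
  fixes k :: nat and t x :: real
  defines "x \<equiv> ln (real k)"
  defines "S \<equiv> x / (4 * ln x)"
  assumes "1 < x" "1 \<le> S" "S * ln (4 * x ^ 2) \<le> x"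
    and F1: "t < x ^ 2 * ln 2" and F2: "t < (S - 1) * (x - S * ln (4 * x ^ 2))"
  shows "exp t < real (g k)"
proof -
  have k: "0 < k" using assms(3) by (cases k) (auto simp: x_def)
  have kx: "exp x = real k" using k by (simp add: x_def)
  define d s where "d = nat \<lceil>x ^ 2\<rceil>" and "s = nat \<lfloor>S\<rfloor>"
  define n where "n = k div (2 * d) ^ s"
  have x2: "1 < x ^ 2" using assms(3) by simp
  have d: "x ^ 2 \<le> real d" "real d \<le> x ^ 2 + 1" using x2 unfolding d_def by linarith+
  have d1: "1 < real d" using d x2 by linarith
  have s: "S - 1 \<le> real s" "real s \<le> S" using assms(4) unfolding s_def by linarith+
  \<comment> \<open>Rounding up gives \<open>d \<le> x ^ 2 + 1 \<le> 2 * x ^ 2\<close>.\<close>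
  have "ln (real (2 * d)) \<le> ln (4 * x ^ 2)" using d d1 x2 by (subst ln_le_cancel_iff) auto
  then have sd: "real s * ln (real (2 * d)) \<le> S * ln (4 * x ^ 2)"
    using s d1 assms(4) by (intro mult_mono) auto
  have pw: "real ((2 * d) ^ s) = exp (real s * ln (real (2 * d)))"
    using d1 by (simp add: exp_of_nat_mult)
  also have "\<dots> \<le> exp x" using sd assms(5) by simp
  finally have "(2 * d) ^ s \<le> k" unfolding kx by (simp only: of_nat_le_iff)
  then have n0: "0 < n" using d1 by (simp add: n_def div_greater_zero_iff)
  have g: "min (2 ^ d) ((n + 1) ^ s) \<le> g k" using n0 by (intro g_lower_bound) (auto simp: n_def)
  have "exp t < exp (real d * ln 2)"
    unfolding exp_less_cancel_iff by (rule less_le_trans[OF F1 mult_right_mono[OF d(1)]]) simp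
  also have "\<dots> = real (2 ^ d)" by (simp add: exp_of_nat_mult)
  finally have 1: "exp t < real (2 ^ d)" .
  \<comment> \<open>The 1 in \<open>n + 1\<close> absorbs the rounding in the integer quotient
    \<open>n\<close>.\<close>
  have "real k < (real n + 1) * real ((2 * d) ^ s)"
  proof -
    have "k < (n + 1) * (2 * d) ^ s"
      using d1 dividend_less_div_times[of "(2 * d) ^ s" k] by (simp add: n_def algebra_simps)
    then have "real k < real ((n + 1) * (2 * d) ^ s)" by (simp only: of_nat_less_iff)
    then show ?thesis by (simp only: of_nat_mult of_nat_add of_nat_1)
  qed
  then have "exp x / exp (real s * ln (real (2 * d))) \<le> real n + 1"
    unfolding kx pw by (simp add: field_simps)
  then have n1: "exp (x - S * ln (4 * x ^ 2)) \<le> real n + 1"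
    using sd by (simp add: exp_diff[symmetric]) (smt (verit) exp_le_cancel_iff)
  have "t < real s * (x - S * ln (4 * x ^ 2))"
    using F2 mult_right_mono[OF s(1), of "x - S * ln (4 * x ^ 2)"] assms(5) by linarith
  then have "exp t < exp (x - S * ln (4 * x ^ 2)) ^ s" by (simp add: exp_of_nat_mult[symmetric])
  also have "\<dots> \<le> (real n + 1) ^ s" using n1 by (intro power_mono) auto
  also have "\<dots> = real ((n + 1) ^ s)" by (simp add: add.commute)
  finally have "exp t < real (min (2 ^ d) ((n + 1) ^ s))" using 1 by (simp add: min_def)
  also have "\<dots> \<le> real (g k)" using g by (simp only: of_nat_le_iff)
  finally show ?thesis .
qed

text \<open>\<open>M\<close> and \<open>H\<close> bound the rounded parameters \<open>m\<close> and
  \<open>h\<close>. \<open>F1\<close> controls the sums, whose exponent has order only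
  \<open>x ^ 2 / (ln x) ^ 3\<close> thanks to the cube in \<open>y\<close>; \<open>F2\<close>
  controls the products, which give the main term \<open>x ^ 2 / ln x\<close>.\<close>

lemma g_lt_exp:
  fixes k :: nat and t u x :: real
  defines "x \<equiv> ln (real k)"
  defines "y \<equiv> x / ln x ^ 3"
  defines "M \<equiv> x / ln y + 1" and "H \<equiv> y + 1"
  assumes "1 < x" "1 < y" "7 \<le> x / ln y" "0 \<le> u"
    and F1: "x + M * H * ln (2 * M ^ 2) \<le> u" and F2: "M * (x + ln H) \<le> u" and F3: "u + ln 3 < t"
  shows "real (g k) < exp t"
proof -
  have k: "0 < k" using assms(5) by (cases k) (auto simp: x_def)
  have kx: "exp x = real k" using k by (simp add: x_def)
  define h m where "h = nat \<lceil>y\<rceil>" and "m = nat \<lceil>x / ln y\<rceil>"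
  have h: "y \<le> real h" "real h \<le> H" using assms(6) unfolding h_def H_def by linarith+
  have m: "x / ln y \<le> real m" "real m \<le> M" using assms(7) unfolding m_def M_def by linarith+
  have m7: "7 \<le> m" using m assms(7) by linarith
  have h1: "1 < h" using h assms(6) by linarith
  have "x \<le> real m * ln y" using m(1) assms(6) by (simp add: field_simps)
  also have "\<dots> \<le> real m * ln (real h)" using h assms(6) by (intro mult_left_mono) auto
  finally have "exp x \<le> exp (real m * ln (real h))" by simp
  also have "\<dots> = real (h ^ m)" using h1 by (simp add: exp_of_nat_mult)
  finally have khm: "k \<le> h ^ m" unfolding kx by (simp only: of_nat_le_iff)
  have M: "7 \<le> M" using m m7 by linarith
  have "real (k * (2 * m ^ 2) ^ (m * h)) = exp (x + real m * real h * ln (2 * real m ^ 2))"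
    using m7 unfolding exp_add kx of_nat_mult[symmetric] exp_of_nat_mult
    by (simp add: power_mult_distrib)
  also have "\<dots> \<le> exp (x + M * H * ln (2 * M ^ 2))"
  proof -
    have m2: "real m ^ 2 \<le> M ^ 2" using m by (intro power_mono) auto
    have m1: "1 \<le> real m ^ 2" using m7 by (simp add: one_le_power)
    have ln1: "ln (2 * real m ^ 2) \<le> ln (2 * M ^ 2)" by (rule ln_mono) (use m1 m2 in linarith)+
    have ln0: "0 \<le> ln (2 * real m ^ 2)" by (rule ln_ge_zero) (use m1 in linarith)
    have mh: "real m * real h \<le> M * H" using m h M by (intro mult_mono) auto
    have MH: "0 \<le> M * H" using M h by simp
    have "real m * real h * ln (2 * real m ^ 2) \<le> M * H * ln (2 * M ^ 2)"
      by (rule mult_mono[OF mh ln1 MH ln0])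
    then show ?thesis by simp
  qed
  also have "\<dots> \<le> exp u" using F1 by simp
  finally have 1: "real (k * (2 * m ^ 2) ^ (m * h)) \<le> exp u" .
  have "real ((k * h) ^ m) = exp (real m * (x + ln (real h)))"
    using h1 by (simp add: exp_add kx exp_of_nat_mult)
  also have "\<dots> \<le> exp (M * (x + ln H))"
  proof -
    have "ln (real h) \<le> ln H" "0 \<le> ln (real h)" using h h1 by simp_all
    then have "real m * (x + ln (real h)) \<le> M * (x + ln H)"
      using m M assms(5) by (intro mult_mono) auto
    then show ?thesis by simp
  qed
  also have "\<dots> \<le> exp u" using F2 by simp
  finally have 2: "real ((k * h) ^ m) \<le> exp u" .
  have "g k \<le> k * (2 * m ^ 2) ^ (m * h) + 1 + (k * h) ^ m"
    using m7 khm k h1 by (intro g_upper_bound) auto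
  then have "real (g k) \<le> real (k * (2 * m ^ 2) ^ (m * h) + 1 + (k * h) ^ m)"
    by (simp only: of_nat_le_iff)
  also have "\<dots> = real (k * (2 * m ^ 2) ^ (m * h)) + 1 + real ((k * h) ^ m)"
    by (simp only: of_nat_add of_nat_1)
  \<comment> \<open>Three summands explain \<open>ln 3\<close> in \<open>F3\<close>; the middle one,
    1, needs \<open>0 \<le> u\<close>.\<close>
  also have "\<dots> \<le> exp u + exp u + exp u" using 1 2 assms(8) by (intro add_mono) auto
  also have "\<dots> = exp (u + ln 3)" by (simp add: exp_add)
  also have "\<dots> < exp t" using F3 by simp
  finally show ?thesis .
qed

theorem theorem2:
  fixes \<epsilon> :: real
  assumes "\<epsilon> > 0"
  shows "\<exists>k\<^sub>0::nat. \<forall>k\<ge>k\<^sub>0.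
           real k powr ((1 / 8 - \<epsilon>) * (ln (real k) / ln (ln (real k)))) < real (g k) \<and>
           real (g k) < real k powr ((1 + \<epsilon>) * (ln (real k) / ln (ln (real k))))"
proof -
  let ?S = "\<lambda>x::real. x / (4 * ln x)"
  let ?y = "\<lambda>x::real. x / ln x ^ 3"
  let ?M = "\<lambda>x::real. x / ln (x / ln x ^ 3) + 1"
  let ?H = "\<lambda>x::real. x / ln x ^ 3 + 1"
  \<comment> \<open>Half of \<open>\<epsilon>\<close> absorbs the lower-order terms in
    \<open>F1\<close> and \<open>F2\<close>, the other half absorbs \<open>ln 3\<close>.\<close>
  let ?u = "\<lambda>x::real. (1 + \<epsilon> / 2) * (x / ln x) * x"
  \<comment> \<open>All hypotheses of \<open>g_gt_exp\<close> and \<open>g_lt_exp\<close> as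
    conditions on \<open>x = ln k\<close> alone, each of which holds for large
    \<open>x\<close>.\<close>
  let ?P = "\<lambda>x::real. 1 < x \<and> 1 \<le> ?S x \<and> ?S x * ln (4 * x ^ 2) \<le> x \<and>
    (1 / 8 - \<epsilon>) * (x / ln x) * x < x ^ 2 * ln 2 \<and>
    (1 / 8 - \<epsilon>) * (x / ln x) * x < (?S x - 1) * (x - ?S x * ln (4 * x ^ 2)) \<and>
    1 < ?y x \<and> 7 \<le> x / ln (?y x) \<and> 0 \<le> ?u x \<and>
    x + ?M x * ?H x * ln (2 * ?M x ^ 2) \<le> ?u x \<and> ?M x * (x + ln (?H x)) \<le> ?u x \<and>
    ?u x + ln 3 < (1 + \<epsilon>) * (x / ln x) * x"
  have "eventually ?P at_top"
    using assms by (intro eventually_conj; real_asymp)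
  moreover have "filterlim (\<lambda>k. ln (real k)) at_top sequentially" by real_asymp
  ultimately have "eventually (\<lambda>k. ?P (ln (real k))) sequentially"
    by (rule eventually_compose_filterlim)
  then obtain K where K: "\<And>k. K \<le> k \<Longrightarrow> ?P (ln (real k))"
    unfolding eventually_sequentially by blast
  show ?thesis
  proof (intro exI[of _ K] allI impI conjI)
    fix k assume "K \<le> k"
    then have P: "?P (ln (real k))" by (rule K)
    have powr: "real k powr c = exp (c * ln (real k))" for c
      using P by (cases k) (auto simp: powr_def)
    show "real k powr ((1 / 8 - \<epsilon>) * (ln (real k) / ln (ln (real k)))) < real (g k)"
      unfolding powr using P by (intro g_gt_exp) blast+
    show "real (g k) < real k powr ((1 + \<epsilon>) * (ln (real k) / ln (ln (real k))))"
      unfolding powr by (rule g_lt_exp[of k "?u (ln (real k))"]) (use P in blast)+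
  qed
qed

end
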